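(* Let $d\ge1$, let $\mathcal J$ be a finite index set, and let $(T,\{M^{[j]}\}_{j\in\mathcal J})$ and $(T',\{M'^{[j]}\}_{j\in\mathcal J})$ be two generic translation-invariant cMPS data of bond dimension $d$, both with finite $p$-number at most $p$. Suppose that $\mathcal C^{(\ell)}_{\mathbf j}(\boldsymbol\tau)=\mathcal C'^{(\ell)}_{\mathbf j}(\boldsymbol\tau)$ for all $1\le\ell\le2p-1$, all $\mathbf j\in\mathcal J^\ell$ and all $\boldsymbol\tau\in[0,\infty)^{\ell-1}$. Then $\mathcal C^{(N)}_{\mathbf j}(\boldsymbol\tau)=\mathcal C'^{(N)}_{\mathbf j}(\boldsymbol\tau)$ for all $N\ge1$, $\mathbf j\in\mathcal J^N$, $\boldsymbol\tau\in[0,\infty)^{N-1}$. In other words, a generic translation-invariant cMPS with $p$-number $p$ is completely characterized by its correlation functions of order at most $2p-1$.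
   Context: Generic translation-invariant cMPS data of bond dimension $d$: for matrices $Q,R\in\mathbb C^{d\times d}$, the Liouvillian $T=Q^*\otimes\mathbb1+\mathbb1\otimes Q+R^*\otimes R\in\mathbb C^{d^2\times d^2}$ has $d^2$ pairwise distinct eigenvalues $\lambda_1,\dots,\lambda_{d^2}$ with $\lambda_1=0$ and $\mathrm{Re}\,\lambda_k<0$ for $k\ge2$; the matrices $M^{[j]}$ are each one of $R^*\otimes\mathbb1$, $\mathbb1\otimes R$, $R^*\otimes R$. Let $e^{T\infty}=\lim_{L\to\infty}e^{TL}$. The correlation function of order $N$ (a normal-ordered correlator of the fields $\Psi,\Psi^\dagger$ at points $0=x_1<\dots<x_N$, $\tau_i=x_{i+1}-x_i$) is $\mathcal C^{(N)}_{\mathbf j}(\boldsymbol\tau)=\mathrm{Tr}\big(M^{[j_N]}e^{T\tau_{N-1}}M^{[j_{N-1}]}\cdots e^{T\tau_1}M^{[j_1]}e^{T\infty}\big)$. Its Laplace transform $\mathcal L^{(N)}_{\mathbf j}(\mathbf s)=\int_{[0,\infty)^{N-1}}e^{-\mathbf s\cdot\boldsymbol\tau}\mathcal C^{(N)}_{\mathbf j}(\boldsymbol\tau)d\boldsymbol\tau$ converges for $\mathrm{Re}\,s_i>0$ and extends to a rational function with poles only along the hyperplanes $\{s_i=\lambda_k\}$. $p$-number: the smallest integer $p$ such that there exist $N\le p$, $\mathbf j\in\mathcal J^N$ and $i$ for which $\mathcal L^{(N)}_{\mathbf j}$ has $d^2$ distinct poles in the variable $s_i$, i.e. a pole along $\{s_i=\lambda_k\}$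 for every $k=1,\dots,d^2$; infinite if no such $p$ exists. *)

theory Defs
  imports "HOL-Analysis.Analysis"
begin

section \<open>Matrices, Kronecker product, matrix exponential\<close>

definition mconj :: "complex^'n^'m \<Rightarrow> complex^'n^'m" where
  "mconj A = (\<chi> i j. cnj (A $ i $ j))"

definition kron :: "complex^'b^'a \<Rightarrow> complex^'d^'c \<Rightarrow> complex^('b \<times> 'd)^('a \<times> 'c)" where
  "kron A B = (\<chi> ik jl. A $ fst ik $ fst jl * B $ snd ik $ snd jl)"

definition mpow :: "complex^'n^'n \<Rightarrow> nat \<Rightarrow> complex^'n^'n" where
  "mpow A n = (((**) A) ^^ n) (mat 1)"

text \<open>Matrix exponential as its power series.\<close>
definition mexp :: "complex^'n^'n \<Rightarrow> complex^'n^'n" where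
  "mexp A = (\<Sum>n. (1 / fact n) *\<^sub>R mpow A n)"

text \<open>Eigenvalues (spectrum) of a square matrix.\<close>
definition mspec :: "complex^'n^'n \<Rightarrow> complex set" where
  "mspec A = {c. \<exists>v. v \<noteq> 0 \<and> A *v v = c *s v}"

section \<open>cMPS data\<close>

text \<open>Liouvillian T = conj(Q) (x) 1 + 1 (x) Q + conj(R) (x) R.\<close>
definition liouv :: "complex^'d^'d \<Rightarrow> complex^'d^'d \<Rightarrow> complex^('d \<times> 'd)^('d \<times> 'd)" where
  "liouv Q R = kron (mconj Q) (mat 1) + kron (mat 1) Q + kron (mconj R) R"

text \<open>Generic translation-invariant cMPS data of bond dimension CARD('d).\<close>
definition generic_cmps ::
  "complex^'d^'d \<Rightarrow> complex^'d^'d \<Rightarrow> ('J \<Rightarrow> complex^('d \<times> 'd)^('d \<times> 'd)) \<Rightarrow> bool" where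
  "generic_cmps Q R M \<longleftrightarrow>
     card (mspec (liouv Q R)) = CARD('d) ^ 2 \<and>
     0 \<in> mspec (liouv Q R) \<and>
     (\<forall>c\<in>mspec (liouv Q R). c \<noteq> 0 \<longrightarrow> Re c < 0) \<and>
     (\<forall>j. M j \<in> {kron (mconj R) (mat 1), kron (mat 1) R, kron (mconj R) R})"

text \<open>e^{T infinity} = lim_{L \<rightarrow> \<infinity>} e^{TL}.\<close>
definition exp_inf :: "complex^'n^'n \<Rightarrow> complex^'n^'n" where
  "exp_inf T = Lim at_top (\<lambda>L::real. mexp (of_real L *s T))"

text \<open>Product M^{[j_N]} e^{T tau_{N-1}} ... e^{T tau_1} M^{[j_1]} e^{T infinity}, with
  zero-based indexing: j k = j_{k+1}, tau k = tau_{k+1}.\<close>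
fun corr_prod :: "complex^'n^'n \<Rightarrow> ('J \<Rightarrow> complex^'n^'n) \<Rightarrow> (nat \<Rightarrow> 'J) \<Rightarrow> (nat \<Rightarrow> real)
    \<Rightarrow> nat \<Rightarrow> complex^'n^'n" where
  "corr_prod T M j \<tau> 0 = exp_inf T"
| "corr_prod T M j \<tau> (Suc 0) = M (j 0) ** exp_inf T"
| "corr_prod T M j \<tau> (Suc (Suc k)) =
     M (j (Suc k)) ** mexp (of_real (\<tau> k) *s T) ** corr_prod T M j \<tau> (Suc k)"

text \<open>Correlation function of order N.\<close>
definition corr :: "complex^'n^'n \<Rightarrow> ('J \<Rightarrow> complex^'n^'n) \<Rightarrow> nat \<Rightarrow> (nat \<Rightarrow> 'J)
    \<Rightarrow> (nat \<Rightarrow> real) \<Rightarrow> complex" where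
  "corr T M N j \<tau> = trace (corr_prod T M j \<tau> N)"

text \<open>Laplace transform (as Lebesgue integral over [0,\<infinity>)^{N-1}).\<close>
definition laplace :: "complex^'n^'n \<Rightarrow> ('J \<Rightarrow> complex^'n^'n) \<Rightarrow> nat \<Rightarrow> (nat \<Rightarrow> 'J)
    \<Rightarrow> (nat \<Rightarrow> complex) \<Rightarrow> complex" where
  "laplace T M N j s =
     (LINT \<tau> | PiM {..<N-1} (\<lambda>_. lborel).
        indicator {\<tau>. \<forall>k<N-1. 0 \<le> \<tau> k} \<tau> *\<^sub>R
        (exp (- (\<Sum>k<N-1. s k * of_real (\<tau> k))) * corr T M N j \<tau>))"

text \<open>F is the (unique) analytic continuation of the Laplace transform from
  Re s_i > 0 to the complement of the hyperplanes s_i = eigenvalue of T.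
  (Separate holomorphy on this open connected set implies joint holomorphy by
  Hartogs; hence F is unique and equals the rational extension.)\<close>
definition laplace_ext :: "complex^'n^'n \<Rightarrow> ('J \<Rightarrow> complex^'n^'n) \<Rightarrow> nat \<Rightarrow> (nat \<Rightarrow> 'J)
    \<Rightarrow> ((nat \<Rightarrow> complex) \<Rightarrow> complex) \<Rightarrow> bool" where
  "laplace_ext T M N j F \<longleftrightarrow>
     (\<forall>s. (\<forall>k<N-1. 0 < Re (s k)) \<longrightarrow> F s = laplace T M N j s) \<and>
     (\<forall>s. (\<forall>k<N-1. s k \<notin> mspec T) \<longrightarrow>
        (\<forall>i<N-1. (\<lambda>z. F (s(i := z))) field_differentiable at (s i)))"

text \<open>Pole of a one-variable function (as in HOL-Complex_Analysis).\<close>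
definition is_pole' :: "(complex \<Rightarrow> complex) \<Rightarrow> complex \<Rightarrow> bool" where
  "is_pole' f a \<longleftrightarrow> filterlim f at_infinity (at a)"

text \<open>F has a pole along the hyperplane {s_i = lam} (i zero-based).\<close>
definition pole_along :: "complex^'n^'n \<Rightarrow> nat \<Rightarrow> ((nat \<Rightarrow> complex) \<Rightarrow> complex) \<Rightarrow> nat
    \<Rightarrow> complex \<Rightarrow> bool" where
  "pole_along T N F i lam \<longleftrightarrow>
     (\<exists>s. (\<forall>k<N-1. k \<noteq> i \<longrightarrow> s k \<notin> mspec T) \<and> is_pole' (\<lambda>z. F (s(i := z))) lam)"

text \<open>The Laplace transform of order N has all eigenvalues of T as poles in variable s_i.\<close>
definition all_poles :: "complex^'n^'n \<Rightarrow> ('J \<Rightarrow> complex^'n^'n) \<Rightarrow> nat \<Rightarrow> (nat \<Rightarrow> 'J)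
    \<Rightarrow> nat \<Rightarrow> bool" where
  "all_poles T M N j i \<longleftrightarrow> i < N - 1 \<and>
     (\<exists>F. laplace_ext T M N j F \<and> (\<forall>lam\<in>mspec T. pole_along T N F i lam))"

text \<open>p-number is finite and at most p.\<close>
definition pnum_le :: "complex^'n^'n \<Rightarrow> ('J \<Rightarrow> complex^'n^'n) \<Rightarrow> nat \<Rightarrow> bool" where
  "pnum_le T M p \<longleftrightarrow> (\<exists>N\<le>p. \<exists>j i. all_poles T M N j i)"

end

theory Submission
  imports Defs "HOL-Complex_Analysis.Conformal_Mappings"
begin

text \<open>
  In an eigenbasis of \<open>T\<close> the correlation function is the \<open>(k0, k0)\<close> entry, \<open>k0\<close> the index of the
  eigenvalue 0, of a product of matrices \<open>m j\<close> and diagonal exponentials, so its Laplace transform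
  is a sum of partial fractions indexed by paths of eigenvalues.  A pole in the variable \<open>s i\<close>
  along every eigenvalue provides, for each index \<open>k\<close>, a path of nonzero matrix entries from \<open>k0\<close> to
  \<open>k0\<close> that visits \<open>k\<close> at step \<open>i\<close>.  Hence the vectors reachable to the right of the \<open>i\<close>-th exponential
  and the covectors reachable to the left of it both span the whole space, with at most \<open>p\<close> matrices
  altogether.  The Hankel matrix of their pairings is therefore invertible; as it is
  also the Hankel matrix of the second system, of the same dimension, comparing the pairings with a
  further matrix inserted yields a similarity between the two systems.  This only needs
  correlations of order up to \<open>p + 1\<close>, and \<open>p + 1 \<le> 2 p - 1\<close> because a pole variable
  requires \<open>p \<ge> 2\<close>.
\<close>

section \<open>Diagonalisation\<close>

definition dmat :: "('n \<Rightarrow> complex) \<Rightarrow> complex^'n^'n" where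
  "dmat e = (\<chi> i j. if i = j then e i else 0)"

lemma dmat_mult_nth [simp]: "(dmat e ** A) $ i $ j = e i * A $ i $ j"
  by (simp add: dmat_def matrix_matrix_mult_def if_distrib[where f="\<lambda>x. x * _"] cong: if_cong)

lemma mult_dmat_nth [simp]: "(A ** dmat e) $ i $ j = A $ i $ j * e j"
  by (simp add: dmat_def matrix_matrix_mult_def if_distrib[where f="\<lambda>x. _ * x"] cong: if_cong)

lemma dmat_mult_vec_nth [simp]: "(dmat e *v x) $ i = e i * x $ i"
  by (simp add: dmat_def matrix_vector_mult_def if_distrib[where f="\<lambda>x. x * _"] cong: if_cong)

lemma dmat_mult_dmat: "dmat e ** dmat f = dmat (\<lambda>k. e k * f k)"
  by (simp add: vec_eq_iff) (simp add: dmat_def)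

lemma transpose_dmat [simp]: "transpose (dmat e) = dmat e"
  by (auto simp: transpose_def dmat_def vec_eq_iff)

text \<open>Applying \<open>T\<close> to a vanishing combination and subtracting \<open>ev a\<close>
  times that combination eliminates \<open>v a\<close>. The other coefficients are multiplied by the
  nonzero differences \<open>ev k - ev a\<close>, so the induction hypothesis kills them.\<close>

lemma eigenvectors_independent:
  fixes T :: "complex^'n^'n"
  assumes "finite K" "inj_on ev K" "\<And>k. k \<in> K \<Longrightarrow> v k \<noteq> 0"
    and "\<And>k. k \<in> K \<Longrightarrow> T *v v k = ev k *s v k"
    and "(\<Sum>k\<in>K. c k *s v k) = 0" "k \<in> K"
  shows "c k = 0"
  using assms
proof (induction K arbitrary: c k rule: finite_induct)
  case empty
  then show ?case by simp
next
  case (insert a K)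
  have eig: "T *v (c k *s v k) = (c k * ev k) *s v k" if "k \<in> insert a K" for k
    using insert.prems(3)[OF that]
    by (simp add: matrix_vector_mult_scaleR vector_scalar_commute mult.commute)
  have "0 = T *v (\<Sum>k\<in>insert a K. c k *s v k)"
    using insert.prems by simp
  also have "\<dots> = (\<Sum>k\<in>insert a K. (c k * ev k) *s v k)"
    unfolding vec.linear_sum[OF matrix_vector_mul_linear_gen]
    by (rule sum.cong[OF refl eig])
  finally have 1: "(\<Sum>k\<in>insert a K. (c k * ev k) *s v k) = 0" by simp
  have "(\<Sum>k\<in>insert a K. (c k * (ev k - ev a)) *s v k) =
      (\<Sum>k\<in>insert a K. (c k * ev k) *s v k) - ev a *s (\<Sum>k\<in>insert a K. c k *s v k)"
    unfolding vec.scale_sum_right sum_subtractf[symmetric]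
    by (rule sum.cong) (auto simp: vec_eq_iff algebra_simps)
  also have "\<dots> = 0" using 1 insert.prems by simp
  finally have 2: "(\<Sum>k\<in>K. (c k * (ev k - ev a)) *s v k) = 0"
    using insert.hyps by simp
  have z: "c k = 0" if "k \<in> K" for k
  proof -
    have "c k * (ev k - ev a) = 0"
      by (rule insert.IH[OF _ _ _ 2 that]) (use insert.prems in auto)
    moreover have "ev k \<noteq> ev a"
      using insert.prems(1) insert.hyps that by (auto simp: inj_on_def)
    ultimately show ?thesis by simp
  qed
  then have "c a *s v a = 0"
    using insert.prems(4) insert.hyps by simp
  then have "c a = 0" using insert.prems(2)[of a] by simp
  with z show ?case using insert.prems(5) by auto
qed

text \<open>There are as many eigenvalues as dimensions, so one eigenvector for each of them fills a
  square matrix \<open>X\<close>. Independence makes its kernel trivial. The eigenvalues are indexed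
  by the matrix index type itself, so that \<open>dmat ev\<close> makes sense.\<close>

lemma spectral_decomposition:
  fixes T :: "complex^'n^'n"
  assumes "card (mspec T) = CARD('n)"
  obtains X Xi :: "complex^'n^'n" and ev :: "'n \<Rightarrow> complex"
  where "bij_betw ev UNIV (mspec T)" "X ** Xi = mat 1" "Xi ** X = mat 1"
    "T = X ** dmat ev ** Xi"
proof -
  have "finite (mspec T)"
    using assms by (metis card.infinite zero_less_card_finite less_numeral_extra(3))
  then obtain ev where ev: "bij_betw ev (UNIV :: 'n set) (mspec T)"
    using assms by (metis finite_same_card_bij finite_code)
  have "\<forall>k. \<exists>v. v \<noteq> 0 \<and> T *v v = ev k *s v"
    using ev unfolding mspec_def bij_betw_def by auto
  then obtain v where v: "\<And>k. v k \<noteq> 0" "\<And>k. T *v v k = ev k *s v k" by metis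
  define X :: "complex^'n^'n" where "X = (\<chi> i k. v k $ i)"
  have inj: "inj ev" using ev by (simp add: bij_betw_def)
  have "a = 0" if "X *v a = 0" for a
  proof -
    have "(\<Sum>k\<in>UNIV. a $ k *s v k) = 0"
      using that unfolding X_def
      by (auto simp: matrix_vector_mult_def vec_eq_iff mult.commute)
    then have "a $ k = 0" for k
      using eigenvectors_independent[OF finite inj v, where c="\<lambda>k. a $ k"] by blast
    then show ?thesis by (simp add: vec_eq_iff)
  qed
  then obtain Xi where Xi: "Xi ** X = mat 1"
    using matrix_left_invertible_ker[of X] by blast
  then have Xi': "X ** Xi = mat 1" by (simp add: matrix_left_right_inverse)
  have "T ** X = X ** dmat ev"
    using v(2) by (simp add: vec_eq_iff) 
      (simp add: X_def matrix_matrix_mult_def matrix_vector_mult_def vec_eq_iff mult.commute)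
  then have "T = X ** dmat ev ** Xi"
    by (metis Xi' matrix_mul_assoc matrix_mul_rid)
  with ev Xi Xi' show ?thesis by (intro that)
qed

text \<open>In \<open>of_real t *s T\<close> the entries acted on by \<open>*s\<close> are the rows
  of \<open>T\<close>. The scalar is therefore itself a vector, multiplied componentwise, and needs
  all its components equal to \<open>t\<close>.\<close>

lemma of_real_vec_nth [simp]: "(of_real t :: complex^'n) $ i = of_real t"
  by (simp add: of_real_def)

lemma mpow_similar:
  fixes X Xi :: "complex^'n^'n"
  assumes "Xi ** X = mat 1" "X ** Xi = mat 1"
  shows "mpow (X ** dmat e ** Xi) n = X ** dmat (\<lambda>k. e k ^ n) ** Xi"
proof (induction n)
  case 0
  have "dmat (\<lambda>k. 1) = (mat 1 :: complex^'n^'n)" by (simp add: dmat_def mat_def)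
  with assms show ?case by (simp add: mpow_def)
next
  case (Suc n)
  have "mpow (X ** dmat e ** Xi) (Suc n) = X ** dmat e ** Xi ** (X ** dmat (\<lambda>k. e k ^ n) ** Xi)"
    using Suc by (simp add: mpow_def)
  also have "\<dots> = X ** (dmat e ** (Xi ** X) ** dmat (\<lambda>k. e k ^ n)) ** Xi"
    by (simp add: matrix_mul_assoc)
  finally show ?case using assms by (simp add: dmat_mult_dmat)
qed

lemma similar_dmat_nth: "(X ** dmat e ** Xi) $ i $ j = (\<Sum>k\<in>UNIV. X $ i $ k * e k * Xi $ k $ j)"
  by (subst matrix_matrix_mult_def) simp

text \<open>Every entry of the exponential series is a finite linear combination of scalar
  exponential series, so convergence and sum can be read off entrywise.\<close>

lemma mexp_similar:
  fixes X Xi :: "complex^'n^'n"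
  assumes "Xi ** X = mat 1" "X ** Xi = mat 1"
  shows "mexp (of_real t *s (X ** dmat ev ** Xi)) = X ** dmat (\<lambda>k. exp (of_real t * ev k)) ** Xi"
proof -
  have *: "of_real t *s (X ** dmat ev ** Xi) = X ** dmat (\<lambda>k. of_real t * ev k) ** Xi"
    by (simp add: vec_eq_iff similar_dmat_nth sum_distrib_left ac_simps)
  have "(\<lambda>n. (1 / fact n) *\<^sub>R mpow (X ** dmat (\<lambda>k. of_real t * ev k) ** Xi) n) sums
      (X ** dmat (\<lambda>k. exp (of_real t * ev k)) ** Xi)"
    unfolding sums_def mpow_similar[OF assms]
  proof (intro vec_tendstoI)
    fix i j
    have "(\<lambda>n. \<Sum>k\<in>UNIV. X $ i $ k * ((of_real t * ev k) ^ n /\<^sub>R fact n) * Xi $ k $ j) sums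
        (\<Sum>k\<in>UNIV. X $ i $ k * exp (of_real t * ev k) * Xi $ k $ j)"
      by (intro sums_sum sums_mult sums_mult2 exp_converges)
    then show "(\<lambda>n. (\<Sum>n<n. (1 / fact n) *\<^sub>R (X ** dmat (\<lambda>k. (of_real t * ev k) ^ n) ** Xi)) $ i $ j)
       \<longlonglongrightarrow> (X ** dmat (\<lambda>k. exp (of_real t * ev k)) ** Xi) $ i $ j"
      by (simp add: sums_def similar_dmat_nth scaleR_sum_right divide_inverse)
  qed
  then show ?thesis unfolding mexp_def * by (simp add: sums_iff)
qed

text \<open>Only the exponential of the eigenvalue 0 survives for large times; the limit is the
  spectral projection belonging to \<open>k0\<close>.\<close>

lemma exp_inf_similar:
  fixes X Xi :: "complex^'n^'n"
  assumes X: "Xi ** X = mat 1" "X ** Xi = mat 1"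
    and k0: "ev k0 = 0" and neg: "\<And>k. k \<noteq> k0 \<Longrightarrow> Re (ev k) < 0"
  shows "exp_inf (X ** dmat ev ** Xi) = X ** dmat (\<lambda>k. if k = k0 then 1 else 0) ** Xi"
proof -
  have lim: "((\<lambda>L::real. exp (of_real L * ev k)) \<longlongrightarrow> (if k = k0 then 1 else 0)) at_top" for k
  proof (cases "k = k0")
    case False
    have "((\<lambda>L::real. exp (Re (ev k) * L)) \<longlongrightarrow> 0) at_top"
      by (rule filterlim_compose[OF exp_at_bot])
         (rule filterlim_tendsto_neg_mult_at_bot[OF tendsto_const neg[OF False] filterlim_ident])
    then have "((\<lambda>L::real. norm (exp (of_real L * ev k))) \<longlongrightarrow> 0) at_top"
      by (simp add: mult.commute)
    then show ?thesis using False tendsto_norm_zero_cancel by fastforce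
  qed (use k0 in simp)
  have "((\<lambda>L::real. X ** dmat (\<lambda>k. exp (of_real L * ev k)) ** Xi) \<longlongrightarrow>
      X ** dmat (\<lambda>k. if k = k0 then 1 else 0) ** Xi) at_top"
    by (intro vec_tendstoI, unfold similar_dmat_nth) (intro tendsto_intros lim)
  then show ?thesis
    unfolding exp_inf_def mexp_similar[OF X] by (intro tendsto_Lim) auto
qed

section \<open>Correlation functions as entries of word products\<close>

fun word_prod :: "(real \<Rightarrow> complex^'n^'n) \<Rightarrow> ('J \<Rightarrow> complex^'n^'n) \<Rightarrow> (real \<times> 'J) list
    \<Rightarrow> complex^'n^'n" where
  "word_prod E m [] = mat 1"
| "word_prod E m ((t, j) # w) = E t ** m j ** word_prod E m w"

lemma word_prod_append: "word_prod E m (u @ w) = word_prod E m u ** word_prod E m w"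
  by (induction E m u rule: word_prod.induct) (simp_all add: matrix_mul_assoc)

text \<open>The list is reversed because later insertions stand further left in the product. The
  last insertion \<open>j n\<close> is not followed by an exponential; it stays outside the word and
  is multiplied on separately.\<close>

definition word_of :: "(nat \<Rightarrow> 'J) \<Rightarrow> (nat \<Rightarrow> real) \<Rightarrow> nat \<Rightarrow> (real \<times> 'J) list" where
  "word_of j \<tau> n = map (\<lambda>q. (\<tau> q, j q)) (rev [0..<n])"

lemma word_of_simps [simp]:
  "word_of j \<tau> 0 = []" "word_of j \<tau> (Suc n) = (\<tau> n, j n) # word_of j \<tau> n"
  by (simp_all add: word_of_def)

definition dexp :: "('n \<Rightarrow> complex) \<Rightarrow> real \<Rightarrow> complex^'n^'n" where
  "dexp ev t = dmat (\<lambda>k. exp (of_real t * ev k))"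

text \<open>The factors \<open>Xi\<close> and \<open>X\<close> cancel between neighbours and, by
  cyclicity of the trace, at the two ends. The infinite-time limit has become the projection
  \<open>?D\<close>, which leaves a single diagonal entry of the trace.\<close>

lemma corr_similar:
  fixes X Xi :: "complex^'n^'n" and M :: "'J \<Rightarrow> complex^'n^'n"
  assumes X: "Xi ** X = mat 1" "X ** Xi = mat 1"
    and k0: "ev k0 = 0" and neg: "\<And>k. k \<noteq> k0 \<Longrightarrow> Re (ev k) < 0"
  defines "m \<equiv> \<lambda>j. Xi ** M j ** X"
  shows "corr (X ** dmat ev ** Xi) M (Suc n) j \<tau> =
    (m (j n) ** word_prod (dexp ev) m (word_of j \<tau> n)) $ k0 $ k0"
proof -
  let ?D = "dmat (\<lambda>k. if k = k0 then 1 else 0)"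
  have cancel: "M i ** X = X ** m i" for i
    unfolding m_def by (simp add: matrix_mul_assoc X)
  have cancel': "A ** Xi ** X = A" for A :: "complex^'n^'n"
    by (simp add: X flip: matrix_mul_assoc)
  have "corr_prod (X ** dmat ev ** Xi) M j \<tau> (Suc n) =
      X ** (m (j n) ** word_prod (dexp ev) m (word_of j \<tau> n)) ** ?D ** Xi"
  proof (induction n)
    case 0
    then show ?case
      by (simp add: exp_inf_similar[where ev = ev, OF X k0 neg] matrix_mul_assoc cancel)
  next
    case (Suc n)
    then show ?case
      by (simp add: mexp_similar[OF X] matrix_mul_assoc cancel cancel' flip: dexp_def)
  qed
  then have "corr (X ** dmat ev ** Xi) M (Suc n) j \<tau> =
      trace (Xi ** (X ** (m (j n) ** word_prod (dexp ev) m (word_of j \<tau> n)) ** ?D))"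
    unfolding corr_def by (metis trace_mul_sym)
  also have "\<dots> = trace (m (j n) ** word_prod (dexp ev) m (word_of j \<tau> n) ** ?D)"
    by (simp add: matrix_mul_assoc X)
  also have "\<dots> = (m (j n) ** word_prod (dexp ev) m (word_of j \<tau> n)) $ k0 $ k0"
    by (simp add: trace_def if_distrib[where f="\<lambda>x. _ * x"] cong: if_cong)
  finally show ?thesis .
qed

section \<open>Laplace transforms and paths\<close>

text \<open>The path runs from \<open>k0\<close> through \<open>f 0\<close>, ...,
  \<open>f (n - 1)\<close> to \<open>k\<close>, where \<open>f q\<close> is the eigenvalue index
  picked out by the exponential at time \<open>\<tau> q\<close>. Each step contributes a matrix
  entry.\<close>

fun path_weight :: "('J \<Rightarrow> complex^'n^'n) \<Rightarrow> (nat \<Rightarrow> 'J) \<Rightarrow> 'n \<Rightarrow> (nat \<Rightarrow> 'n) \<Rightarrow> nat \<Rightarrow> 'n \<Rightarrow> complex"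
  where
    "path_weight m j k0 f 0 k = m (j 0) $ k $ k0"
  | "path_weight m j k0 f (Suc n) k = m (j (Suc n)) $ k $ f n * path_weight m j k0 f n (f n)"

lemma path_weight_cong:
  "(\<And>q. q < n \<Longrightarrow> f q = g q) \<Longrightarrow> path_weight m j k0 f n k = path_weight m j k0 g n k"
  by (induction n arbitrary: k) auto

text \<open>A nonzero product has nonzero factors. The case distinctions supply the endpoints
  \<open>k0\<close> and \<open>k\<close>, which \<open>f\<close> does not store.\<close>

lemma path_weight_nonzero:
  assumes "path_weight m j k0 f n k \<noteq> 0" "q \<le> n"
  shows "m (j q) $ (if q = n then k else f q) $ (if q = 0 then k0 else f (q - 1)) \<noteq> 0"
  using assms
proof (induction n arbitrary: k)
  case (Suc n)
  then show ?case
    by (cases "q = Suc n") (force simp: le_Suc_eq split: if_splits)+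
qed simp

lemma sum_PiE_insert:
  fixes h :: "('i \<Rightarrow> 'n::finite) \<Rightarrow> 'b::comm_monoid_add"
  assumes "i \<notin> I"
  shows "sum h (PiE (insert i I) (\<lambda>_. UNIV)) = (\<Sum>k\<in>UNIV. \<Sum>f\<in>PiE I (\<lambda>_. UNIV). h (f(i := k)))"
proof -
  have "inj_on (\<lambda>(y, g). g(i := y)) (UNIV \<times> PiE I (\<lambda>_. UNIV :: 'n set))"
    using inj_combinator[OF assms, of "\<lambda>_. UNIV"] by simp
  then show ?thesis
    unfolding PiE_insert_eq sum.cartesian_product
    by (subst sum.reindex) (auto simp: case_prod_unfold)
qed

text \<open>Multiplying out all matrix products gives a sum over paths; since the exponentials are
  diagonal, the times enter each summand only through one scalar factor per step.\<close>

lemma word_prod_path_expansion: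
  fixes m :: "'J \<Rightarrow> complex^'n^'n"
  shows "(m (j n) ** word_prod (dexp ev) m (word_of j \<tau> n)) $ k $ k0 =
    (\<Sum>f\<in>PiE {..<n} (\<lambda>_. UNIV). path_weight m j k0 f n k *
      (\<Prod>q<n. exp (of_real (\<tau> q) * ev (f q))))"
proof (induction n arbitrary: k)
  case 0
  then show ?case by simp
next
  case (Suc n)
  let ?e = "\<lambda>q k. exp (of_real (\<tau> q) * ev k)"
  have "(m (j (Suc n)) ** word_prod (dexp ev) m (word_of j \<tau> (Suc n))) $ k $ k0 =
      ((m (j (Suc n)) ** dexp ev (\<tau> n)) ** (m (j n) ** word_prod (dexp ev) m (word_of j \<tau> n))) $ k $ k0"
    by (simp add: matrix_mul_assoc)
  also have "\<dots> = (\<Sum>k'\<in>UNIV. m (j (Suc n)) $ k $ k' * ?e n k' *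
      (m (j n) ** word_prod (dexp ev) m (word_of j \<tau> n)) $ k' $ k0)"
    by (subst matrix_matrix_mult_def) (simp add: dexp_def)
  also have "\<dots> = (\<Sum>k'\<in>UNIV. \<Sum>f\<in>PiE {..<n} (\<lambda>_. UNIV).
      path_weight m j k0 (f(n := k')) (Suc n) k * (\<Prod>q<Suc n. ?e q ((f(n := k')) q)))"
  proof (intro sum.cong refl)
    fix k'
    \<comment> \<open>The weight up to step \<open>n\<close> reads \<open>f\<close> only below
      \<open>n\<close>, so fixing the new node \<open>k'\<close> does not disturb it.\<close>
    have *: "path_weight m j k0 (f(n := k')) n k' = path_weight m j k0 f n k'" for f
      by (rule path_weight_cong) auto
    show "m (j (Suc n)) $ k $ k' * ?e n k' *
        (m (j n) ** word_prod (dexp ev) m (word_of j \<tau> n)) $ k' $ k0 =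
      (\<Sum>f\<in>PiE {..<n} (\<lambda>_. UNIV).
        path_weight m j k0 (f(n := k')) (Suc n) k * (\<Prod>q<Suc n. ?e q ((f(n := k')) q)))"
      unfolding Suc.IH sum_distrib_left
      by (intro sum.cong refl) (simp add: * mult_ac)
  qed
  also have "\<dots> = (\<Sum>f\<in>PiE {..<Suc n} (\<lambda>_. UNIV). path_weight m j k0 f (Suc n) k *
      (\<Prod>q<Suc n. ?e q (f q)))"
    unfolding lessThan_Suc by (rule sum_PiE_insert[symmetric]) simp
  finally show ?case .
qed

section \<open>Laplace integrals of exponentials on the half line\<close>

lemma integrable_exp_halfline:
  fixes z :: complex
  assumes "Re z > 0"
  shows "integrable lborel (\<lambda>t::real. indicator {0..} t *\<^sub>R exp (- (z * of_real t)))"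
proof -
  let ?a = "Re z"
  have lim: "((\<lambda>t. - exp (- ?a * t) / ?a) \<longlongrightarrow> 0) at_top"
  proof -
    have "((\<lambda>t. exp (- ?a * t)) \<longlongrightarrow> 0) at_top"
      by (rule filterlim_compose[OF exp_at_bot])
         (rule filterlim_tendsto_neg_mult_at_bot[OF tendsto_const _ filterlim_ident],
           use assms in simp)
    from tendsto_divide[OF tendsto_minus[OF this] tendsto_const[of ?a]] show ?thesis
      using assms by simp
  qed
  have "(\<integral>\<^sup>+ t. ennreal (exp (- ?a * t)) * indicator {0..} t \<partial>lborel) = ennreal (0 - (- exp (- ?a * 0) / ?a))"
    by (rule nn_integral_FTC_atLeast[OF _ _ _ lim])
       (use assms in \<open>auto intro!: derivative_eq_intros\<close>)
  moreover have "ennreal (exp (- ?a * t)) * indicator {0..} t =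
      ennreal (indicator {0..} t *\<^sub>R exp (- ?a * t))" for t
    by (auto simp: indicator_def)
  ultimately have "integrable lborel (\<lambda>t. indicator {0..} t *\<^sub>R exp (- ?a * t))"
    by (intro integrableI_nonneg) auto
  \<comment> \<open>The norm of the complex integrand is the real exponential just
    integrated.\<close>
  then show ?thesis
    by (rule Bochner_Integration.integrable_bound) (auto simp: indicator_def)
qed

text \<open>The integral up to \<open>y\<close> is \<open>(1 - exp (- (z * y))) / z\<close> by the
  fundamental theorem of calculus; the exponential dies out as \<open>y\<close> grows.\<close>

lemma integral_exp_halfline:
  fixes z :: complex
  assumes "Re z > 0"
  shows "(LINT t|lborel. indicator {0..} t *\<^sub>R exp (- (z * of_real t))) = 1 / z"
proof -
  let ?f = "\<lambda>t::real. indicator {0..} t *\<^sub>R exp (- (z * of_real t))"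
  have z: "z \<noteq> 0" using assms by auto
  have "((\<lambda>y. LINT t|lborel. indicator {..y} t *\<^sub>R ?f t) \<longlongrightarrow> (LINT t|lborel. ?f t)) at_top"
    by (rule tendsto_integral_at_top[OF _ integrable_exp_halfline[OF assms]]) simp
  moreover have "((\<lambda>y. LINT t|lborel. indicator {..y} t *\<^sub>R ?f t) \<longlongrightarrow> 1 / z) at_top"
  proof -
    have "(LINT t|lborel. indicator {..y} t *\<^sub>R ?f t) = (1 - exp (- (z * of_real y))) / z" if "y \<ge> 0" for y
    proof -
      have "has_bochner_integral lborel (\<lambda>t. indicator {0..y} t *\<^sub>R exp (- (z * of_real t)))
          (- exp (- (z * of_real y)) / z - (- exp (- (z * of_real 0)) / z))"
      proof (rule has_bochner_integral_FTC_Icc[OF that])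
        fix t
        show "((\<lambda>t. - exp (- (z * of_real t)) / z) has_vector_derivative exp (- (z * of_real t)))
            (at t within {0..y})"
          by (rule has_vector_derivative_real_field[where f = "\<lambda>w. - exp (- (z * w)) / z"])
             (use z in \<open>auto intro!: derivative_eq_intros\<close>)
      qed (auto intro!: continuous_intros)
      then have "(LINT t|lborel. indicator {0..y} t *\<^sub>R exp (- (z * of_real t))) =
          (1 - exp (- (z * of_real y))) / z"
        by (simp add: has_bochner_integral_iff diff_divide_distrib)
      moreover have "indicator {..y} t *\<^sub>R ?f t = indicator {0..y} t *\<^sub>R exp (- (z * of_real t))" for t
        by (auto simp: indicator_def)
      ultimately show ?thesis by simp
    qed
    then have "\<forall>\<^sub>F y in at_top. (1 - exp (- (z * of_real y))) / z =
        (LINT t|lborel. indicator {..y} t *\<^sub>R ?f t)"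
      by (intro eventually_mono[OF eventually_ge_at_top[of 0]]) simp
    moreover have "((\<lambda>y::real. (1 - exp (- (z * of_real y))) / z) \<longlongrightarrow> (1 - 0) / z) at_top"
    proof (intro tendsto_intros z)
      have "((\<lambda>y::real. exp (- Re z * y)) \<longlongrightarrow> 0) at_top"
        by (rule filterlim_compose[OF exp_at_bot])
           (rule filterlim_tendsto_neg_mult_at_bot[OF tendsto_const _ filterlim_ident],
             use assms in simp)
      then have "((\<lambda>y::real. norm (exp (- (z * of_real y)))) \<longlongrightarrow> 0) at_top" by simp
      then show "((\<lambda>y::real. exp (- (z * of_real y))) \<longlongrightarrow> 0) at_top"
        by (rule tendsto_norm_zero_cancel)
    qed
    ultimately show ?thesis by (simp add: tendsto_cong)
  qed
  ultimately show ?thesis by (rule tendsto_unique[rotated 1]) simp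
qed

section \<open>The rational extension of the Laplace transform and its poles\<close>

definition partial_fractions ::
  "((nat \<Rightarrow> 'n) \<Rightarrow> complex) \<Rightarrow> ('n \<Rightarrow> complex) \<Rightarrow> nat \<Rightarrow> (nat \<Rightarrow> complex) \<Rightarrow> complex" where
  "partial_fractions c ev n s =
    (\<Sum>f\<in>PiE {..<n} (\<lambda>_. UNIV). c f * (\<Prod>q<n. 1 / (s q - ev (f q))))"

text \<open>Each path contributes a product of functions of one time each, so its integral factors
  over the variables. The half-line integrals converge because \<open>s q - ev (f q)\<close> has
  positive real part.\<close>

lemma laplace_eq_partial_fractions:
  fixes T :: "complex^'n^'n" and ev :: "'n \<Rightarrow> complex"
  assumes corr: "\<And>\<tau>. corr T M (Suc n) j \<tau> =
      (\<Sum>f\<in>PiE {..<n} (\<lambda>_. UNIV). c f * (\<Prod>q<n. exp (of_real (\<tau> q) * ev (f q))))"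
    and ev: "\<And>k. Re (ev k) \<le> 0" and s: "\<And>q. q < n \<Longrightarrow> 0 < Re (s q)"
  shows "laplace T M (Suc n) j s = partial_fractions c ev n s"
proof -
  interpret product_sigma_finite "\<lambda>_::nat. lborel :: real measure"
    by standard
  let ?g = "\<lambda>f q t. indicator {0..} t *\<^sub>R exp (- ((s q - ev (f q)) * of_real t))"
  have pos: "Re (s q - ev (f q)) > 0" if "q < n" for f :: "nat \<Rightarrow> 'n" and q
    using s[OF that] ev[of "f q"] by simp
  have eq: "indicator {\<tau>. \<forall>k<n. 0 \<le> \<tau> k} \<tau> *\<^sub>R
        (exp (- (\<Sum>k<n. s k * of_real (\<tau> k))) * corr T M (Suc n) j \<tau>) =
      (\<Sum>f\<in>PiE {..<n} (\<lambda>_. UNIV). c f * (\<Prod>q<n. ?g f q (\<tau> q)))" for \<tau>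
  proof -
    have ind: "indicator {\<tau>. \<forall>k<n. 0 \<le> \<tau> k} \<tau> = (\<Prod>q<n. indicator {0..} (\<tau> q) :: real)"
      by (induction n) (auto simp: indicator_def less_Suc_eq)
    have ex: "(\<Prod>q<n. exp (- (s q * of_real (\<tau> q)))) = exp (- (\<Sum>k<n. s k * of_real (\<tau> k)))"
      by (simp add: exp_sum sum_negf[symmetric])
    have "(\<Prod>q<n. ?g f q (\<tau> q)) = (\<Prod>q<n. complex_of_real (indicator {0..} (\<tau> q))) *
        ((\<Prod>q<n. exp (- (s q * of_real (\<tau> q)))) * (\<Prod>q<n. exp (of_real (\<tau> q) * ev (f q))))" for f
      unfolding prod.distrib[symmetric]
      by (intro prod.cong refl)
         (simp add: scaleR_conv_of_real exp_add[symmetric] algebra_simps)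
    then show ?thesis
      unfolding corr ind ex
      by (simp add: scaleR_conv_of_real sum_distrib_left mult_ac)
  qed
  have int: "integrable (Pi\<^sub>M {..<n} (\<lambda>_. lborel)) (\<lambda>\<tau>. \<Prod>q<n. ?g f q (\<tau> q))" for f
    by (rule product_integrable_prod) (use pos integrable_exp_halfline in auto)
  have val: "(LINT \<tau>|Pi\<^sub>M {..<n} (\<lambda>_. lborel). (\<Prod>q<n. ?g f q (\<tau> q))) = (\<Prod>q<n. 1 / (s q - ev (f q)))" for f
    by (subst product_integral_prod)
       (use pos integrable_exp_halfline integral_exp_halfline in auto)
  have "laplace T M (Suc n) j s =
      (LINT \<tau>|Pi\<^sub>M {..<n} (\<lambda>_. lborel). (\<Sum>f\<in>PiE {..<n} (\<lambda>_. UNIV). c f * (\<Prod>q<n. ?g f q (\<tau> q))))"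
    unfolding laplace_def diff_Suc_1 eq ..
  also have "\<dots> = partial_fractions c ev n s"
    unfolding partial_fractions_def
    by (subst Bochner_Integration.integral_sum) (use int val in auto)
  finally show ?thesis .
qed

text \<open>With all other variables frozen, the function is a sum of simple fractions in
  \<open>z\<close> with constant coefficients. Both its holomorphy and its behaviour at an
  eigenvalue are visible in this form.\<close>

lemma partial_fractions_update:
  assumes "i < n"
  shows "partial_fractions c ev n (s(i := z)) =
    (\<Sum>f\<in>PiE {..<n} (\<lambda>_. UNIV). c f * (\<Prod>q\<in>{..<n} - {i}. 1 / (s q - ev (f q))) * (1 / (z - ev (f i))))"
  unfolding partial_fractions_def
proof (intro sum.cong refl)
  fix f
  have "(\<Prod>q<n. 1 / ((s(i := z)) q - ev (f q))) =
      1 / (z - ev (f i)) * (\<Prod>q\<in>{..<n} - {i}. 1 / ((s(i := z)) q - ev (f q)))"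
    using assms by (subst prod.remove[of _ i]) auto
  also have "(\<Prod>q\<in>{..<n} - {i}. 1 / ((s(i := z)) q - ev (f q))) = (\<Prod>q\<in>{..<n} - {i}. 1 / (s q - ev (f q)))"
    by (intro prod.cong) auto
  finally show "c f * (\<Prod>q<n. 1 / ((s(i := z)) q - ev (f q))) =
      c f * (\<Prod>q\<in>{..<n} - {i}. 1 / (s q - ev (f q))) * (1 / (z - ev (f i)))"
    by (simp add: mult_ac)
qed

text \<open>The identity theorem is applied to one variable after the other; the first r variables
  have already left the right half plane.\<close>

lemma laplace_ext_unique:
  fixes T :: "complex^'n^'n" and ev :: "'n \<Rightarrow> complex"
  assumes ext: "laplace_ext T M (Suc n) j F"
    and range: "range ev = mspec T" and ev: "\<And>k. Re (ev k) \<le> 0"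
    and lap: "\<And>s. (\<And>q. q < n \<Longrightarrow> 0 < Re (s q)) \<Longrightarrow>
      laplace T M (Suc n) j s = partial_fractions c ev n s"
    and "\<And>q. q < n \<Longrightarrow> s q \<notin> mspec T"
  shows "F s = partial_fractions c ev n s"
proof -
  have "F s = partial_fractions c ev n s"
    if "r \<le> n" "\<And>q. q < n \<Longrightarrow> s q \<notin> mspec T" "\<And>q. r \<le> q \<Longrightarrow> q < n \<Longrightarrow> 0 < Re (s q)" for r s
    using that
  proof (induction r arbitrary: s)
    case 0
    then show ?case using ext lap unfolding laplace_ext_def by auto
  next
    case (Suc r)
    let ?U = "UNIV - mspec T"
    have fin: "finite (mspec T)" by (simp flip: range)
    have "F (s(r := s r)) = partial_fractions c ev n (s(r := s r))"
    proof (rule analytic_continuation_open[where s = "{z. 0 < Re z}" and s' = ?U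
          and f = "\<lambda>z. F (s(r := z))" and g = "\<lambda>z. partial_fractions c ev n (s(r := z))"])
      show "open {z. 0 < Re z}" by (rule open_halfspace_Re_gt)
      show "open ?U" using fin by (simp add: finite_imp_closed open_Diff)
      have "1 \<in> {z. 0 < Re z}" by simp
      then show "{z. 0 < Re z} \<noteq> {}" by blast
      show "connected ?U" by (rule connected_open_delete_finite) (use fin in auto)
      show sub: "{z. 0 < Re z} \<subseteq> ?U"
        unfolding range[symmetric] using ev by (auto simp: not_less[symmetric])
      have "(\<lambda>z. F (s(r := z))) field_differentiable at z" if "z \<in> ?U" for z
      proof -
        have "\<forall>k<n. (s(r := z)) k \<notin> mspec T" using Suc.prems that by auto
        then have "(\<lambda>w. F ((s(r := z))(r := w))) field_differentiable at ((s(r := z)) r)"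
          using ext Suc.prems(1) unfolding laplace_ext_def by (metis Suc_le_lessD diff_Suc_1)
        then show ?thesis by simp
      qed
      then show "(\<lambda>z. F (s(r := z))) holomorphic_on ?U"
        by (auto simp: holomorphic_on_def intro: field_differentiable_at_within)
      show "(\<lambda>z. partial_fractions c ev n (s(r := z))) holomorphic_on ?U"
        unfolding partial_fractions_update[OF Suc_le_lessD[OF Suc.prems(1)]]
        by (intro holomorphic_intros) (auto simp flip: range)
      \<comment> \<open>With \<open>z\<close> in the right half plane, variable \<open>r\<close> has
        not yet left it, so the induction hypothesis applies to the updated point.\<close>
      show "F (s(r := z)) = partial_fractions c ev n (s(r := z))" if "z \<in> {z. 0 < Re z}" for z
      proof (rule Suc.IH)
        have "z \<notin> mspec T"
          using that sub by blast
        then show "(s(r := z)) q \<notin> mspec T" if "q < n" for q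
          using Suc.prems(2)[OF that] by simp
        show "0 < Re ((s(r := z)) q)" if "r \<le> q" "q < n" for q
          using Suc.prems(3)[of q] that \<open>z \<in> {z. 0 < Re z}\<close> by (cases "q = r") auto
      qed (use Suc.prems in auto)
      show "s r \<in> ?U" using Suc.prems by auto
    qed
    then show ?case by simp
  qed
  from this[of n] assms(5) show ?thesis by simp
qed

text \<open>If every path visiting \<open>k\<close> at step \<open>i\<close> had coefficient 0, no
  term singular at \<open>ev k\<close> would remain, by injectivity of \<open>ev\<close>. The
  function would then have a finite limit there, which contradicts the pole.\<close>

lemma pole_along_path:
  fixes T :: "complex^'n^'n" and ev :: "'n \<Rightarrow> complex"
  assumes F: "\<And>s. (\<And>q. q < n \<Longrightarrow> s q \<notin> mspec T) \<Longrightarrow> F s = partial_fractions c ev n s"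
    and range: "range ev = mspec T" and "inj ev" and "i < n"
    and pole: "pole_along T (Suc n) F i (ev k)"
  shows "\<exists>f. f i = k \<and> c f \<noteq> 0"
proof (rule ccontr)
  assume none: "\<nexists>f. f i = k \<and> c f \<noteq> 0"
  obtain s where s: "\<And>q. q < n \<Longrightarrow> q \<noteq> i \<Longrightarrow> s q \<notin> mspec T"
    and lim: "filterlim (\<lambda>z. F (s(i := z))) at_infinity (at (ev k))"
    using pole unfolding pole_along_def is_pole'_def by auto
  let ?G = "\<lambda>z. partial_fractions c ev n (s(i := z))"
  \<comment> \<open>A finite spectrum leaves a punctured neighbourhood of \<open>ev k\<close> free
    of eigenvalues; on it \<open>F\<close> agrees with \<open>?G\<close>.\<close>
  have fin: "finite (mspec T)" by (simp flip: range)
  have "\<forall>\<^sub>F z in at (ev k). z \<in> UNIV - (mspec T - {ev k}) - {ev k}"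
    by (rule eventually_at_in_open) (use fin in \<open>auto simp: open_Diff finite_imp_closed\<close>)
  then have "\<forall>\<^sub>F z in at (ev k). F (s(i := z)) = ?G z"
    by eventually_elim (rule F, use s in auto)
  from filterlim_cong[OF refl refl this] lim have "filterlim ?G at_infinity (at (ev k))"
    by simp
  moreover have "(?G \<longlongrightarrow> ?G (ev k)) (at (ev k))"
    unfolding partial_fractions_update[OF \<open>i < n\<close>]
  proof (intro tendsto_sum)
    fix f :: "nat \<Rightarrow> 'n"
    let ?a = "c f * (\<Prod>q\<in>{..<n} - {i}. 1 / (s q - ev (f q)))"
    show "((\<lambda>z. ?a * (1 / (z - ev (f i)))) \<longlongrightarrow> ?a * (1 / (ev k - ev (f i)))) (at (ev k))"
    proof (cases "f i = k")
      case True
      then show ?thesis using none by auto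
    next
      case False
      then have "ev k - ev (f i) \<noteq> 0" using \<open>inj ev\<close> by (auto simp: inj_def)
      then show ?thesis by (intro tendsto_intros) auto
    qed
  qed
  ultimately show False
    using not_tendsto_and_filterlim_at_infinity[of "at (ev k)"] by auto
qed

section \<open>Reachable vectors and the Hankel matrix\<close>

lemma dmat_poly_mem_subspace:
  fixes V :: "(complex^'n) set" and a :: "'n \<Rightarrow> complex"
  assumes V: "vec.subspace V" and pw: "\<And>i. dmat (\<lambda>k. a k ^ i) *v x \<in> V"
  shows "dmat (\<lambda>k. poly p (a k)) *v x \<in> V"
proof -
  have "dmat (\<lambda>k. poly p (a k)) *v x = (\<Sum>i\<le>degree p. coeff p i *s (dmat (\<lambda>k. a k ^ i) *v x))"
    by (simp add: vec_eq_iff poly_altdef sum_distrib_right mult.assoc)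
  also have "\<dots> \<in> V"
    by (intro vec.subspace_sum[OF V] vec.subspace_scale[OF V] pw)
  finally show ?thesis .
qed

text \<open>The complex exponential is injective where imaginary parts stay below \<pi> in absolute
  value. A short enough time, here \<open>1 / b\<close>, brings all scaled eigenvalues into that
  strip.\<close>

lemma inj_exp_time:
  fixes ev :: "'n::finite \<Rightarrow> complex"
  assumes "inj ev"
  obtains t :: real where "t > 0" "inj (\<lambda>k. exp (of_real t * ev k))"
proof -
  define b where "b = 1 + (\<Sum>k\<in>UNIV. norm (ev k))"
  have b: "norm (ev k) < b" for k
    using member_le_sum[of k UNIV "\<lambda>k. norm (ev k)"] by (simp add: b_def)
  have b0: "b > 0" using b[of undefined] norm_ge_zero[of "ev undefined"] by linarith
  have im: "\<bar>Im (of_real (1 / b) * ev k)\<bar> < 1" for k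
  proof -
    have "\<bar>Im (of_real (1 / b) * ev k)\<bar> \<le> norm (of_real (1 / b) * ev k)"
      by (rule abs_Im_le_cmod)
    also have "\<dots> = norm (ev k) / b" using b0 by (simp add: norm_mult norm_divide)
    also have "\<dots> < 1" using b b0 by simp
    finally show ?thesis .
  qed
  show ?thesis
  proof
    show "1 / b > 0" using b0 by simp
    show "inj (\<lambda>k. exp (of_real (1 / b) * ev k))"
    proof (rule injI)
      fix k l assume e: "exp (of_real (1 / b) * ev k) = exp (of_real (1 / b) * ev l)"
      have "of_real (1 / b) * ev k = of_real (1 / b) * ev l"
        by (rule exp_complex_eqI[OF _ e]) (use im[of k] im[of l] pi_gt3 in linarith)
      then show "k = l" using b0 assms by (auto simp: inj_def)
    qed
  qed
qed

text \<open>A subspace that is invariant under the diagonal semigroup is invariant under its spectral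
  projections, which are polynomials in the semigroup at a time where the exponentials of
  the eigenvalues are distinct.\<close>

lemma axis_mem_of_orbit:
  fixes ev :: "'n::finite \<Rightarrow> complex" and x :: "complex^'n"
  assumes V: "vec.subspace V" and "inj ev"
    and orbit: "\<And>t. t \<ge> 0 \<Longrightarrow> dexp ev t *v x \<in> V" and "x $ k \<noteq> 0"
  shows "axis k 1 \<in> V"
proof -
  obtain t :: real where t: "t > 0" "inj (\<lambda>k. exp (of_real t * ev k))"
    using inj_exp_time[OF \<open>inj ev\<close>] by blast
  define a where "a = (\<lambda>k. exp (of_real t * ev k))"
  \<comment> \<open>The Lagrange polynomial of the node \<open>a k\<close>, up to
    normalisation.\<close>
  define p where "p = (\<Prod>l\<in>UNIV - {k}. [:- a l, 1:])"
  \<comment> \<open>Powers of the semigroup at time \<open>t\<close> are the semigroup at the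
    nonnegative times \<open>i * t\<close>, so the orbit assumption covers them.\<close>
  have "dmat (\<lambda>k. a k ^ i) = dexp ev (of_nat i * t)" for i
    unfolding dexp_def a_def by (simp add: exp_of_nat_mult mult.assoc)
  then have "dmat (\<lambda>k. a k ^ i) *v x \<in> V" for i
    using orbit t(1) by simp
  then have mem: "dmat (\<lambda>k. poly p (a k)) *v x \<in> V"
    by (rule dmat_poly_mem_subspace[OF V])
  have pk: "poly p (a k) \<noteq> 0"
    using t(2) by (auto simp: p_def poly_prod a_def inj_def)
  have pl: "poly p (a l) = 0" if "l \<noteq> k" for l
    using that by (auto simp: p_def poly_prod)
  have "axis k 1 = inverse (poly p (a k) * x $ k) *s (dmat (\<lambda>k. poly p (a k)) *v x)"
    using pk pl \<open>x $ k \<noteq> 0\<close> by (auto simp: vec_eq_iff axis_def field_simps)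
  then show ?thesis using mem V by (simp add: vec.subspace_scale)
qed

section \<open>Axis vectors reached by words of fixed length\<close>

definition nonneg_word :: "(real \<times> 'J) list \<Rightarrow> bool" where
  "nonneg_word w \<longleftrightarrow> (\<forall>(t, j)\<in>set w. 0 \<le> t)"

lemma nonneg_word_simps [simp]:
  "nonneg_word []" "nonneg_word ((t, j) # w) \<longleftrightarrow> 0 \<le> t \<and> nonneg_word w"
  "nonneg_word (u @ w) \<longleftrightarrow> nonneg_word u \<and> nonneg_word w"
  by (auto simp: nonneg_word_def)

lemma column_mult: "column k (A ** B) = A *v column k B"
  by (simp add: column_def matrix_matrix_mult_def matrix_vector_mult_def vec_eq_iff)

lemma mult_axis_nth: "((A :: complex^'n^'m) *v axis k 1) $ i = A $ i $ k"
  by (simp add: matrix_vector_mult_def axis_def if_distrib[where f="\<lambda>x. _ * x"] cong: if_cong)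

text \<open>Follow the path \<open>g\<close>: the image of the axis of \<open>g n\<close> under
  \<open>m (j n)\<close> has a nonzero component at \<open>g (Suc n)\<close>, and letting the time
  of the new letter vary isolates that component inside the span.\<close>

lemma axis_reachable:
  fixes ev :: "'n::finite \<Rightarrow> complex"
  assumes "inj ev" and "\<And>q. q < n \<Longrightarrow> m (j q) $ g (Suc q) $ g q \<noteq> 0"
  shows "axis (g n) 1 \<in> vec.span ((\<lambda>w. column (g 0) (word_prod (dexp ev) m w)) `
    {w. nonneg_word w \<and> length w = n})"
  using assms(2)
proof (induction n)
  case 0
  have "column (g 0) (mat 1) = (axis (g 0) 1 :: complex^'n)"
    by (auto simp: column_def mat_def axis_def vec_eq_iff)
  then show ?case by (intro vec.span_base image_eqI[where x="[]"]) auto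
next
  case (Suc n)
  let ?W = "\<lambda>n. {w. nonneg_word w \<and> length w = n}"
  let ?V = "\<lambda>n. vec.span ((\<lambda>w. column (g 0) (word_prod (dexp ev) m w)) ` ?W n)"
  have IH: "axis (g n) 1 \<in> ?V n" using Suc by simp
  have "dexp ev t *v (m (j n) *v axis (g n) 1) \<in> ?V (Suc n)" if "t \<ge> 0" for t
  proof -
    \<comment> \<open>Prepending the letter \<open>(t, j n)\<close> lengthens every word by one, and
      linearity carries this over to the span.\<close>
    have "(dexp ev t ** m (j n)) *v x \<in> ?V (Suc n)" if "x \<in> ?V n" for x
      using that
    proof (induction rule: vec.span_induct_alt)
      case base
      then show ?case by (simp add: vec.span_zero)
    next
      case (step c x y)
      then obtain w where w: "w \<in> ?W n" "x = column (g 0) (word_prod (dexp ev) m w)" by auto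
      have "(dexp ev t ** m (j n)) *v x \<in> ?V (Suc n)"
        unfolding w column_mult[symmetric] using w \<open>t \<ge> 0\<close>
        by (intro vec.span_base image_eqI[where x="(t, j n) # w"]) auto
      with step show ?case
        by (simp add: matrix_vector_right_distrib vector_scalar_commute vec.span_add vec.span_scale)
    qed
    from this[OF IH] show ?thesis by (simp add: matrix_vector_mul_assoc)
  qed
  then show ?case
    using Suc.prems[of n]
    by (intro axis_mem_of_orbit[OF vec.subspace_span \<open>inj ev\<close>,
          where x="m (j n) *v axis (g n) 1"]) (simp_all add: mult_axis_nth)
qed

section \<open>Bases formed by reachable vectors and covectors\<close>

lemma invertible_transpose_iff:
  fixes A :: "'a::field^'n^'n"
  shows "invertible (transpose A) \<longleftrightarrow> invertible A"
  using left_invertible_transpose[of A] by (simp add: invertible_left_inverse matrix_left_right_inverse)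

text \<open>The axes make the family spanning. A basis extracted from it has \<open>CARD('n)\<close>
  elements, so it can be indexed by \<open>'n\<close> and used as the columns of a square
  matrix.\<close>

lemma exists_invertible_columns:
  fixes g :: "'w \<Rightarrow> complex^'n"
  assumes "\<And>k. axis k 1 \<in> vec.span (g ` W)"
  shows "\<exists>h :: 'n \<Rightarrow> 'w. (\<forall>a. h a \<in> W) \<and> invertible (\<chi> i a. g (h a) $ i)"
proof -
  have "x \<in> vec.span (g ` W)" for x :: "complex^'n"
  proof -
    have "x = (\<Sum>k\<in>UNIV. x $ k *s axis k 1)"
      by (simp add: vec_eq_iff axis_def if_distrib[where f="\<lambda>x. _ * x"] cong: if_cong)
    also have "\<dots> \<in> vec.span (g ` W)"
      by (intro vec.span_sum vec.span_scale assms)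
    finally show ?thesis .
  qed
  then have full: "vec.span (g ` W) = UNIV" by auto
  obtain B where B: "B \<subseteq> g ` W" "vec.independent B" "g ` W \<subseteq> vec.span B"
    using vec.maximal_independent_subset by blast
  have spanB: "vec.span B = UNIV"
    using B(3) full vec.span_minimal[OF B(3) vec.subspace_span] by auto
  then have "card B = CARD('n)"
    using vec.dim_eq_card[of B UNIV] B(2) by (metis vec.dim_UNIV vec_dim_card vec.span_UNIV)
  moreover from this have "finite B"
    by (metis card.infinite zero_less_card_finite less_numeral_extra(3))
  ultimately obtain b where b: "bij_betw b (UNIV :: 'n set) B"
    by (metis finite_same_card_bij finite)
  have "b a \<in> g ` W" for a using b B(1) by (auto simp: bij_betw_def)
  then have "\<forall>a. \<exists>w. w \<in> W \<and> g w = b a" by (metis imageE)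
  then obtain h where h: "\<And>a. h a \<in> W" "\<And>a. g (h a) = b a" by metis
  have "columns (\<chi> i a. g (h a) $ i) = B"
    using b by (auto simp: columns_def column_def h bij_betw_def)
  then have "invertible (\<chi> i a. g (h a) $ i)"
    unfolding invertible_right_inverse matrix_right_invertible_span_columns by (simp add: spanB)
  with h(1) show ?thesis by blast
qed

text \<open>The mirror image of \<open>word_prod\<close>: its rows are the covectors reached by the
  transposed matrices, so reachability for covectors follows from that for vectors.\<close>

fun word_prod_left :: "(real \<Rightarrow> complex^'n^'n) \<Rightarrow> ('J \<Rightarrow> complex^'n^'n) \<Rightarrow> (real \<times> 'J) list
    \<Rightarrow> complex^'n^'n" where
  "word_prod_left E m [] = mat 1"
| "word_prod_left E m ((t, j) # w) = word_prod_left E m w ** m j ** E t"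

lemma transpose_word_prod:
  "transpose (word_prod (dexp ev) (\<lambda>j. transpose (m j)) w) = word_prod_left (dexp ev) m w"
  by (induction "dexp ev" m w rule: word_prod_left.induct)
     (simp_all add: matrix_transpose_mul matrix_mul_assoc, simp_all add: dexp_def)

text \<open>Shifting the pairing of matrices with exponentials by one position turns the product
  into the left part of a correlation function. The data \<open>j\<close>, \<open>u\<close>,
  \<open>t\<close> are chosen before \<open>E\<close> and \<open>m\<close>, so that the same ones
  serve both systems.\<close>

lemma word_prod_left_eq:
  assumes "w \<noteq> []" "nonneg_word w"
  shows "\<exists>j u t. 0 \<le> t \<and> nonneg_word u \<and> Suc (length u) = length w \<and>
    (\<forall>(E :: real \<Rightarrow> complex^'n^'n) m. word_prod_left E m w = m j ** word_prod E m u ** E t)"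
  using assms
proof (induction w)
  case (Cons a w)
  obtain t j where a: "a = (t, j)" by force
  show ?case
  proof (cases "w = []")
    case True
    then show ?thesis using Cons.prems a
      by (intro exI[of _ j] exI[of _ "[]"] exI[of _ t]) auto
  next
    case False
    moreover have "nonneg_word w" using Cons.prems a by simp
    ultimately obtain j0 u t0 where "0 \<le> t0" "nonneg_word u" "Suc (length u) = length w"
      "\<forall>(E :: real \<Rightarrow> complex^'n^'n) m. word_prod_left E m w = m j0 ** word_prod E m u ** E t0"
      using Cons.IH by blast
    then show ?thesis using Cons.prems a
      \<comment> \<open>The trailing time \<open>t0\<close> of the shorter product joins the matrix
        of the new letter, and the new time \<open>t\<close> becomes the trailing one.\<close>
      by (intro exI[of _ j0] exI[of _ "u @ [(t0, j)]"] exI[of _ t])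
         (auto simp: word_prod_append matrix_mul_assoc)
  qed
qed simp

section \<open>Similarity from equal Hankel pairings\<close>

lemma matrix_rows_columns_nth:
  fixes P R :: "'n \<Rightarrow> complex^'n^'n"
  shows "((\<chi> b. P b $ k) ** A ** (\<chi> i a. R a $ i $ k)) $ b $ a = (P b ** A ** R a) $ k $ k"
  by (simp add: matrix_matrix_mult_def)

text \<open>Row \<open>k\<close> of each \<open>P b\<close> and column \<open>k\<close> of each
  \<open>R a\<close> form matrices \<open>C\<close> and \<open>B\<close> whose product is the Hankel
  matrix shared by both systems. As it is invertible, comparing the factorisations
  \<open>C ** B = C' ** B'\<close> yields the change of basis.\<close>

lemma hankel_similarity:
  fixes P R P' R' :: "'n \<Rightarrow> complex^'n^'n"
  assumes C: "invertible (\<chi> b. P b $ k)" and B: "invertible (\<chi> i a. R a $ i $ k)"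
    and PR: "\<And>a b. (P b ** R a) $ k $ k = (P' b ** R' a) $ k' $ k'"
    and P: "\<And>b. P b $ k $ k = P' b $ k' $ k'"
    and R: "\<And>a. R a $ k $ k = R' a $ k' $ k'"
  obtains S Si where "S ** Si = mat 1" "Si ** S = mat 1"
    "S $ k' = axis k 1" "column k' Si = axis k 1"
    "\<forall>A A'. (\<forall>a b. (P b ** A ** R a) $ k $ k = (P' b ** A' ** R' a) $ k' $ k') \<longrightarrow>
      A' = S ** A ** Si"
proof -
  define C where "C = (\<chi> b. P b $ k)"
  define B where "B = (\<chi> i a. R a $ i $ k)"
  define C' where "C' = (\<chi> b. P' b $ k')"
  define B' where "B' = (\<chi> i a. R' a $ i $ k')"
  obtain Ci where Ci: "C ** Ci = mat 1" "Ci ** C = mat 1"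
    using C unfolding invertible_def C_def by blast
  obtain Bi where Bi: "B ** Bi = mat 1" "Bi ** B = mat 1"
    using B unfolding invertible_def B_def by blast
  have mid: "C ** A ** B = C' ** A' ** B'"
    if "\<And>a b. (P b ** A ** R a) $ k $ k = (P' b ** A' ** R' a) $ k' $ k'" for A A'
    unfolding C_def B_def C'_def B'_def
    by (simp only: vec_eq_iff matrix_rows_columns_nth that) simp
  have CB: "C ** B = C' ** B'"
    using mid[of "mat 1" "mat 1"] PR by simp
  \<comment> \<open>Chosen so that \<open>S\<close> takes the reachable vectors of the first system
    to those of the second, \<open>B' = S ** B\<close>, and dually
    \<open>C' = C ** Si\<close>.\<close>
  define S where "S = B' ** Bi"
  define Si where "Si = Ci ** C'"
  have "Si ** S = Ci ** (C' ** B') ** Bi" by (simp add: S_def Si_def matrix_mul_assoc)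
  also have "\<dots> = Ci ** C ** (B ** Bi)" by (simp add: matrix_mul_assoc flip: CB)
  finally have SiS: "Si ** S = mat 1" by (simp add: Ci Bi)
  then have SSi: "S ** Si = mat 1" by (simp add: matrix_left_right_inverse)
  show ?thesis
  proof (rule that[OF SSi SiS])
    have "B' $ k' = B $ k" by (simp add: B_def B'_def R vec_eq_iff)
    then have "S $ k' = (B ** Bi) $ k" by (simp add: S_def matrix_matrix_mult_def)
    then show "S $ k' = axis k 1" by (auto simp: Bi mat_def axis_def vec_eq_iff)
    have "column k' C' = column k C" by (simp add: C_def C'_def P vec_eq_iff column_def)
    then have "column k' Si = column k (Ci ** C)" by (simp add: Si_def column_mult)
    then show "column k' Si = axis k 1" by (auto simp: Ci mat_def axis_def column_def vec_eq_iff)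
  next
    show "\<forall>A A'. (\<forall>a b. (P b ** A ** R a) $ k $ k = (P' b ** A' ** R' a) $ k' $ k') \<longrightarrow>
      A' = S ** A ** Si"
    proof (intro allI impI)
      fix A A'
      assume "\<forall>a b. (P b ** A ** R a) $ k $ k = (P' b ** A' ** R' a) $ k' $ k'"
      then have "Ci ** (C ** A ** B) ** Bi = Ci ** (C' ** A' ** B') ** Bi" by (simp add: mid)
      moreover have "Ci ** (C ** A ** B) ** Bi = (Ci ** C) ** A ** (B ** Bi)"
        by (simp only: matrix_mul_assoc)
      ultimately have "A = Si ** A' ** S"
        by (simp add: Ci Bi S_def Si_def matrix_mul_assoc)
      then have "S ** A ** Si = (S ** Si) ** A' ** (S ** Si)" by (simp only: matrix_mul_assoc)
      then show "A' = S ** A ** Si" by (simp add: SSi)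
    qed
  qed
qed

section \<open>Short correlations determine all correlations\<close>

lemma dexp_add: "dexp ev (s + t) = dexp ev s ** dexp ev t"
  by (simp add: dexp_def dmat_mult_dmat exp_add distrib_right)

lemma mult_dexp_nth: "(A ** dexp ev t) $ i $ j = A $ i $ j * exp (of_real t * ev j)"
  and dexp_mult_nth: "(dexp ev t ** A) $ i $ j = exp (of_real t * ev i) * A $ i $ j"
  by (simp_all add: dexp_def)

text \<open>Vectors are reached by words of length \<open>Suc i\<close>, covectors by words of
  length \<open>n - i\<close>. With one more matrix between them a pairing contains
  \<open>n + 2\<close> matrices, that is, a leading one and a word of length \<open>Suc n\<close>,
  exactly the range of the assumed equalities.\<close>

lemma correlations_determined:
  fixes ev ev' :: "'n::finite \<Rightarrow> complex" and m m' :: "'J \<Rightarrow> complex^'n^'n"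
  assumes "inj ev" and k0: "ev k0 = 0" "ev' k0' = 0" and "i < n"
    and path: "\<And>k. \<exists>g. g 0 = k0 \<and> g (Suc i) = k \<and> g (Suc n) = k0 \<and>
      (\<forall>q\<le>n. m (j q) $ g (Suc q) $ g q \<noteq> 0)"
    and eq: "\<And>j w. nonneg_word w \<Longrightarrow> length w \<le> Suc n \<Longrightarrow>
      (m j ** word_prod (dexp ev) m w) $ k0 $ k0 = (m' j ** word_prod (dexp ev') m' w) $ k0' $ k0'"
    and "nonneg_word w"
  shows "(m l ** word_prod (dexp ev) m w) $ k0 $ k0 = (m' l ** word_prod (dexp ev') m' w) $ k0' $ k0'"
proof -
  let ?E = "dexp ev" and ?E' = "dexp ev'"
  let ?W = "\<lambda>n. {w :: (real \<times> 'J) list. nonneg_word w \<and> length w = n}"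
  have "axis k 1 \<in> vec.span ((\<lambda>w. column k0 (word_prod ?E m w)) ` ?W (Suc i))" for k
  proof -
    obtain g where g: "g 0 = k0" "g (Suc i) = k" "g (Suc n) = k0"
      "\<And>q. q \<le> n \<Longrightarrow> m (j q) $ g (Suc q) $ g q \<noteq> 0"
      using path[of k] by blast
    show ?thesis
      using axis_reachable[OF \<open>inj ev\<close>, where n="Suc i" and g=g and m=m and j=j] g \<open>i < n\<close> by auto
  qed
  then obtain r :: "'n \<Rightarrow> (real \<times> 'J) list" where r: "\<forall>a. r a \<in> ?W (Suc i)"
    "invertible (\<chi> i a. column k0 (word_prod ?E m (r a)) $ i)"
    by (rule exE[OF exists_invertible_columns], elim conjE) (rule that)
  have "axis k 1 \<in> vec.span ((\<lambda>w. column k0 (word_prod ?E (\<lambda>j. transpose (m j)) w)) ` ?W (n - i))" for k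
  proof -
    obtain g where g: "g 0 = k0" "g (Suc i) = k" "g (Suc n) = k0"
      "\<And>q. q \<le> n \<Longrightarrow> m (j q) $ g (Suc q) $ g q \<noteq> 0"
      using path[of k] by blast
    \<comment> \<open>Read backwards from its end, the path leads from \<open>k0\<close> to
      \<open>k\<close> in \<open>n - i\<close> steps along the transposed matrices.\<close>
    have "transpose (m (j (n - q))) $ g (Suc n - Suc q) $ g (Suc n - q) \<noteq> 0" if "q < n - i" for q
      using g(4)[of "n - q"] that by (simp add: transpose_def Suc_diff_le)
    then show ?thesis
      using axis_reachable[OF \<open>inj ev\<close>, where n="n - i" and g="\<lambda>q. g (Suc n - q)"
          and m="\<lambda>j. transpose (m j)" and j="\<lambda>q. j (n - q)"] g \<open>i < n\<close> by simp
  qed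
  then obtain p :: "'n \<Rightarrow> (real \<times> 'J) list" where p: "\<forall>a. p a \<in> ?W (n - i)"
    "invertible (\<chi> i a. column k0 (word_prod ?E (\<lambda>j. transpose (m j)) (p a)) $ i)"
    by (rule exE[OF exists_invertible_columns], elim conjE) (rule that)
  have "(\<chi> i a. column k0 (word_prod ?E (\<lambda>j. transpose (m j)) (p a)) $ i) =
      transpose (\<chi> b. word_prod_left ?E m (p b) $ k0)"
    unfolding transpose_word_prod[symmetric] by (simp add: transpose_def column_def)
  then have invC: "invertible (\<chi> b. word_prod_left ?E m (p b) $ k0)"
    using p(2) by (simp add: invertible_transpose_iff)
  have invB: "invertible (\<chi> i a. word_prod ?E m (r a) $ i $ k0)"
    using r(2) by (simp add: column_def)
  have pform: "\<exists>j u t. 0 \<le> t \<and> nonneg_word u \<and> Suc (length u) = n - i \<and>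
    (\<forall>(E :: real \<Rightarrow> complex^'n^'n) m. word_prod_left E m (p b) = m j ** word_prod E m u ** E t)" for b
  proof -
    have p': "p b \<noteq> []" "nonneg_word (p b)" "n - i = length (p b)"
      using p(1)[rule_format, of b] \<open>i < n\<close> by auto
    show ?thesis unfolding p'(3) by (rule word_prod_left_eq[OF p'(1,2)])
  qed
  have rform: "\<exists>j u t. 0 \<le> t \<and> nonneg_word u \<and> length u = i \<and> r a = (t, j) # u" for a
  proof -
    have "nonneg_word (r a)" "length (r a) = Suc i" using r(1)[rule_format, of a] by auto
    then obtain t j u where "r a = (t, j) # u" "length u = i"
      by (metis length_Suc_conv surj_pair)
    with \<open>nonneg_word (r a)\<close> show ?thesis by auto
  qed
  have PER: "(word_prod_left ?E m (p b) ** ?E s ** word_prod ?E m (r a)) $ k0 $ k0 =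
      (word_prod_left ?E' m' (p b) ** ?E' s ** word_prod ?E' m' (r a)) $ k0' $ k0'"
    if "s \<ge> 0" for s a b
  proof -
    obtain j u t where P: "0 \<le> t" "nonneg_word u" "Suc (length u) = n - i"
      "\<And>(E :: real \<Rightarrow> complex^'n^'n) m. word_prod_left E m (p b) = m j ** word_prod E m u ** E t"
      using pform[of b] by blast
    obtain j' u' t' where R: "0 \<le> t'" "nonneg_word u'" "length u' = i" "r a = (t', j') # u'"
      using rform[of a] by blast
    show ?thesis
      \<comment> \<open>The trailing time of the covector, the inserted \<open>s\<close> and the
        first time of the vector merge into one letter by the semigroup law.\<close>
      using eq[of "u @ (t + s + t', j') # u'" j] P R \<open>i < n\<close> that
      by (simp add: word_prod_append dexp_add matrix_mul_assoc)
  qed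
  have PMR: "(word_prod_left ?E m (p b) ** m l ** word_prod ?E m (r a)) $ k0 $ k0 =
      (word_prod_left ?E' m' (p b) ** m' l ** word_prod ?E' m' (r a)) $ k0' $ k0'" for l a b
  proof -
    obtain j u t where P: "0 \<le> t" "nonneg_word u" "Suc (length u) = n - i"
      "\<And>(E :: real \<Rightarrow> complex^'n^'n) m. word_prod_left E m (p b) = m j ** word_prod E m u ** E t"
      using pform[of b] by blast
    show ?thesis
      using eq[of "u @ (t, l) # r a" j] P r(1)[rule_format, of a] \<open>i < n\<close>
      by (simp add: word_prod_append matrix_mul_assoc)
  qed
  have zero: "dexp e 0 = mat 1" for e :: "'n \<Rightarrow> complex"
    by (simp add: dexp_def dmat_def mat_def)
  \<comment> \<open>In this and the next fact the outer exponential acts at the index of the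
    eigenvalue 0, where it equals 1, so what remains is a correlation.\<close>
  have P: "word_prod_left ?E m (p b) $ k0 $ k0 = word_prod_left ?E' m' (p b) $ k0' $ k0'" for b
  proof -
    obtain j u t where P: "0 \<le> t" "nonneg_word u" "Suc (length u) = n - i"
      "\<And>(E :: real \<Rightarrow> complex^'n^'n) m. word_prod_left E m (p b) = m j ** word_prod E m u ** E t"
      using pform[of b] by blast
    then show ?thesis using eq[of u j] by (simp add: mult_dexp_nth k0)
  qed
  have R: "word_prod ?E m (r a) $ k0 $ k0 = word_prod ?E' m' (r a) $ k0' $ k0'" for a
  proof -
    obtain j' u' t' where R: "0 \<le> t'" "nonneg_word u'" "length u' = i" "r a = (t', j') # u'"
      using rform[of a] by blast
    then show ?thesis using eq[of u' j'] \<open>i < n\<close>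
      by (simp add: dexp_mult_nth k0 flip: matrix_mul_assoc)
  qed
  have PR: "(word_prod_left ?E m (p b) ** word_prod ?E m (r a)) $ k0 $ k0 =
      (word_prod_left ?E' m' (p b) ** word_prod ?E' m' (r a)) $ k0' $ k0'" for a b
    using PER[of 0 b a] by (simp add: zero)
  obtain S Si where S: "S ** Si = mat 1" "Si ** S = mat 1"
    "S $ k0' = axis k0 1" "column k0' Si = axis k0 1"
    and Seq: "\<forall>A A'. (\<forall>a b. (word_prod_left ?E m (p b) ** A ** word_prod ?E m (r a)) $ k0 $ k0 =
      (word_prod_left ?E' m' (p b) ** A' ** word_prod ?E' m' (r a)) $ k0' $ k0') \<longrightarrow>
      A' = S ** A ** Si"
    by (rule hankel_similarity[OF invC invB PR P R]) (rule that)
  \<comment> \<open>The exponential is itself treated as a matrix inserted in the pairing.\<close>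
  have SE: "?E' t = S ** ?E t ** Si" if "t \<ge> 0" for t
    by (rule Seq[rule_format]) (rule PER[OF that])
  have Sm: "m' l = S ** m l ** Si" for l
    by (rule Seq[rule_format]) (rule PMR)
  have cancel: "A ** Si ** S = A" for A :: "complex^'n^'n"
    by (simp add: S flip: matrix_mul_assoc)
  have Sw: "word_prod ?E' m' w = S ** word_prod ?E m w ** Si"
    using \<open>nonneg_word w\<close>
    by (induction w) (auto simp: S SE Sm matrix_mul_assoc cancel)
  have "m' l ** word_prod ?E' m' w = S ** (m l ** word_prod ?E m w) ** Si"
    by (simp add: Sw Sm matrix_mul_assoc cancel)
  \<comment> \<open>Row \<open>k0'\<close> of \<open>S\<close> and column \<open>k0'\<close> of
    \<open>Si\<close> are axis vectors at \<open>k0\<close>, so the similarity preserves the entry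
    that defines the correlation.\<close>
  moreover have "(S ** A ** Si) $ k0' $ k0' = A $ k0 $ k0" for A
  proof -
    have "Si $ q $ k0' = (if q = k0 then 1 else 0)" for q
      using arg_cong[OF S(4), of "\<lambda>v. v $ q"] by (auto simp: column_def axis_def)
    then show ?thesis
      by (simp add: matrix_matrix_mult_def S(3) axis_def if_distrib[where f="\<lambda>x. x * _"]
          if_distrib[where f="\<lambda>x. _ * x"] cong: if_cong)
  qed
  ultimately show ?thesis by simp
qed

section \<open>The reconstruction theorem\<close>

lemma word_of_surj:
  assumes "nonneg_word w"
  obtains j \<tau> where "j (length w) = l" "word_of j \<tau> (length w) = w" "\<forall>q<length w. 0 \<le> \<tau> q"
proof -
  \<comment> \<open>The letters are read from the right, in the order of time; the value at
    \<open>length w\<close> is the leading matrix outside the word.\<close>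
  define j where "j = (\<lambda>q. if q = length w then l else snd (rev w ! q))"
  define \<tau> where "\<tau> = (\<lambda>q. fst (rev w ! q))"
  show ?thesis
  proof (rule that[of j \<tau>])
    show "j (length w) = l" by (simp add: j_def)
    show "word_of j \<tau> (length w) = w"
      unfolding word_of_def j_def \<tau>_def by (rule nth_equalityI) (auto simp: rev_nth)
    show "\<forall>q<length w. 0 \<le> \<tau> q"
    proof (intro allI impI)
      fix q assume "q < length w"
      then have "rev w ! q \<in> set w" by (metis length_rev nth_mem set_rev)
      then show "0 \<le> \<tau> q"
        using assms by (auto simp: \<tau>_def nonneg_word_def case_prod_unfold)
    qed
  qed
qed

lemma nonneg_word_of: "nonneg_word (word_of j \<tau> n) \<longleftrightarrow> (\<forall>q<n. 0 \<le> \<tau> q)"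
  by (induction n) (auto simp: less_Suc_eq)

lemma corr_diagonal_form:
  fixes T :: "complex^'n^'n" and M :: "'J \<Rightarrow> complex^'n^'n"
  assumes "card (mspec T) = CARD('n)" "0 \<in> mspec T" "\<forall>c\<in>mspec T. c \<noteq> 0 \<longrightarrow> Re c < 0"
  obtains ev :: "'n \<Rightarrow> complex" and k0 :: 'n and m :: "'J \<Rightarrow> complex^'n^'n"
  where "inj ev" "range ev = mspec T" "ev k0 = 0"
    "\<forall>n j \<tau>. corr T M (Suc n) j \<tau> =
      (m (j n) ** word_prod (dexp ev) m (word_of j \<tau> n)) $ k0 $ k0"
proof -
  obtain X Xi :: "complex^'n^'n" and ev where ev: "bij_betw ev UNIV (mspec T)"
    and X: "X ** Xi = mat 1" "Xi ** X = mat 1" and T: "T = X ** dmat ev ** Xi"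
    using spectral_decomposition[OF assms(1)] by blast
  from ev have inj: "inj ev" and range: "range ev = mspec T"
    by (auto simp: bij_betw_def)
  from assms(2) range obtain k0 where k0: "ev k0 = 0" by (metis imageE)
  have neg: "Re (ev k) < 0" if "k \<noteq> k0" for k
    using assms(3) range inj k0 that by (metis injD rangeI)
  show ?thesis
    by (rule that[OF inj range k0]) (unfold T, intro allI, rule corr_similar[where ev=ev, OF X(2,1) k0 neg])
qed

text \<open>A pole along \<open>ev k\<close> yields a path of nonzero weight with
  \<open>f i = k\<close>, hence nonzero entries along it. The labels \<open>j\<close> are the same
  for all \<open>k\<close>; only the path varies.\<close>

lemma all_poles_path:
  fixes T :: "complex^'n^'n" and ev :: "'n \<Rightarrow> complex"
  assumes poles: "all_poles T M (Suc n) j i"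
    and range: "range ev = mspec T" and "inj ev" and ev: "\<And>k. Re (ev k) \<le> 0"
    and corr: "\<And>\<tau>. corr T M (Suc n) j \<tau> =
      (m (j n) ** word_prod (dexp ev) m (word_of j \<tau> n)) $ k0 $ k0"
  shows "\<exists>g. g 0 = k0 \<and> g (Suc i) = k \<and> g (Suc n) = k0 \<and>
      (\<forall>q\<le>n. m (j q) $ g (Suc q) $ g q \<noteq> 0)"
proof -
  let ?c = "\<lambda>f. path_weight m j k0 f n k0"
  obtain F where "i < n" and ext: "laplace_ext T M (Suc n) j F"
    and pole: "\<And>k. pole_along T (Suc n) F i (ev k)"
    using poles unfolding all_poles_def range[symmetric] by auto
  have lap: "laplace T M (Suc n) j s = partial_fractions ?c ev n s"
    if "\<And>q. q < n \<Longrightarrow> 0 < Re (s q)" for s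
    by (rule laplace_eq_partial_fractions[OF _ ev that])
       (simp_all add: corr word_prod_path_expansion)
  have F: "F s = partial_fractions ?c ev n s" if "\<And>q. q < n \<Longrightarrow> s q \<notin> mspec T" for s
    by (rule laplace_ext_unique[OF ext range ev lap that])
  obtain f where f: "f i = k" "?c f \<noteq> 0"
    using pole_along_path[OF F range \<open>inj ev\<close> \<open>i < n\<close> pole] by blast
  \<comment> \<open>Counting the endpoint \<open>k0\<close> as node 0 shifts \<open>f\<close> by
    one, and node \<open>Suc n\<close> closes the path at \<open>k0\<close>.\<close>
  let ?g = "\<lambda>q. if q = 0 \<or> q = Suc n then k0 else f (q - 1)"
  have "m (j q) $ ?g (Suc q) $ ?g q \<noteq> 0" if "q \<le> n" for q
    using path_weight_nonzero[OF f(2) that] that by (auto split: if_splits)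
  then show ?thesis using f(1) \<open>i < n\<close> by (intro exI[of _ ?g]) auto
qed

theorem mainTheorem4:
  fixes Q R Q' R' :: "complex^'d::finite^'d"
    and M M' :: "'J::finite \<Rightarrow> complex^('d \<times> 'd)^('d \<times> 'd)"
    and p :: nat
  assumes gen: "generic_cmps Q R M" and gen': "generic_cmps Q' R' M'"
    and pn: "pnum_le (liouv Q R) M p" and pn': "pnum_le (liouv Q' R') M' p"
    and eq: "\<And>l j \<tau>. 1 \<le> l \<Longrightarrow> l \<le> 2 * p - 1 \<Longrightarrow> (\<forall>k<l-1. 0 \<le> \<tau> k) \<Longrightarrow>
               corr (liouv Q R) M l j \<tau> = corr (liouv Q' R') M' l j \<tau>"
  shows "\<forall>N j \<tau>. 1 \<le> N \<longrightarrow> (\<forall>k<N-1. 0 \<le> \<tau> k) \<longrightarrow>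
           corr (liouv Q R) M N j \<tau> = corr (liouv Q' R') M' N j \<tau>"
proof (intro allI impI)
  fix N :: nat and j :: "nat \<Rightarrow> 'J" and \<tau> :: "nat \<Rightarrow> real"
  assume "1 \<le> N" and \<tau>: "\<forall>k<N-1. 0 \<le> \<tau> k"
  define T where "T = liouv Q R"
  define T' where "T' = liouv Q' R'"
  have spec: "card (mspec T) = CARD('d \<times> 'd)" "0 \<in> mspec T"
      "\<forall>c\<in>mspec T. c \<noteq> 0 \<longrightarrow> Re c < 0"
    using gen by (auto simp: generic_cmps_def T_def power2_eq_square)
  have spec': "card (mspec T') = CARD('d \<times> 'd)" "0 \<in> mspec T'"
      "\<forall>c\<in>mspec T'. c \<noteq> 0 \<longrightarrow> Re c < 0"
    using gen' by (auto simp: generic_cmps_def T'_def power2_eq_square)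
  obtain ev :: "'d \<times> 'd \<Rightarrow> complex" and k0 m where ev: "inj ev" "range ev = mspec T" "ev k0 = 0" and
    corr: "\<forall>n j \<tau>. corr T M (Suc n) j \<tau> =
      (m (j n) ** word_prod (dexp ev) m (word_of j \<tau> n)) $ k0 $ k0"
    by (rule corr_diagonal_form[OF spec, where M=M]) (rule that, assumption+)
  obtain ev' :: "'d \<times> 'd \<Rightarrow> complex" and k0' m' where ev': "inj ev'" "range ev' = mspec T'" "ev' k0' = 0" and
    corr': "\<forall>n j \<tau>. corr T' M' (Suc n) j \<tau> =
      (m' (j n) ** word_prod (dexp ev') m' (word_of j \<tau> n)) $ k0' $ k0'"
    by (rule corr_diagonal_form[OF spec', where M=M']) (rule that, assumption+)
  have Re: "Re (ev k) \<le> 0" for k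
  proof (cases "ev k = 0")
    case False
    then show ?thesis using spec(3) ev(2) by force
  qed simp
  obtain L jp i where L: "L \<le> p" "all_poles T M L jp i"
    using pn unfolding pnum_le_def T_def by blast
  then have "i < L - 1" by (simp add: all_poles_def)
  then obtain n where n: "L = Suc n" "i < n" by (cases L) auto
  have words: "(m l ** word_prod (dexp ev) m w) $ k0 $ k0 = (m' l ** word_prod (dexp ev') m' w) $ k0' $ k0'"
    if w0: "nonneg_word w" "length w \<le> Suc n" for l w
  proof -
    obtain j \<tau> where w: "j (length w) = l" "word_of j \<tau> (length w) = w"
      "\<forall>q<length w. 0 \<le> \<tau> q"
      by (rule word_of_surj[OF w0(1), of l]) (rule that, assumption+)
    \<comment> \<open>The order is at most \<open>n + 2\<close>, hence at most \<open>p + 1\<close>.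
      Since \<open>i < n\<close> forces \<open>n\<close> to be positive, \<open>p\<close> is at
      least 2 and the order is at most \<open>2 * p - 1\<close>.\<close>
    have "corr T M (Suc (length w)) j \<tau> = corr T' M' (Suc (length w)) j \<tau>"
      unfolding T_def T'_def by (rule eq) (use w(3) w0(2) n L(1) in auto)
    then show ?thesis by (simp add: corr corr' w)
  qed
  obtain K where K: "N = Suc K" using \<open>1 \<le> N\<close> by (cases N) auto
  have "nonneg_word (word_of j \<tau> K)" using \<tau> K by (simp add: nonneg_word_of)
  then have "corr T M N j \<tau> = corr T' M' N j \<tau>"
    unfolding K corr[rule_format] corr'[rule_format]
    using correlations_determined[where i=i and n=n and j=jp, OF ev(1,3) ev'(3) n(2)
        all_poles_path[OF L(2)[unfolded n(1)] ev(2,1) Re corr[rule_format]] words]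
    by blast
  then show "corr (liouv Q R) M N j \<tau> = corr (liouv Q' R') M' N j \<tau>"
    by (simp add: T_def T'_def)
qed

end
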